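(* Let $\rho$ be a rectangular metric on $\mathbb{Z}^d$ and let $B_n=\{u\in\mathbb{Z}^d:\rho(u,0)\le n\}$ for $n\ge1$. Then the upper and lower critical dimensions with respect to $\{B_n\}_{n\ge1}$ are invariants of metric isomorphism. That is, if two non-singular ergodic $\mathbb{Z}^d$-actions on standard probability spaces $(X,\mu)$ and $(Y,\nu)$ are metrically isomorphic, then they have the same lower critical dimension $\alpha(B_n)$ and the same upper critical dimension $\beta(B_n)$.
   Context: A $\mathbb{Z}^d$-action on $(X,\mu)$ is non-singular if $\mu\circ u\sim\mu$ for each $u$; then $\omega_u=\frac{d\mu\circ u}{d\mu}$. For $t\in\mathbb{R}$ let $$L_t=\Big\{x:\liminf_{n\to\infty}\tfrac{1}{|B_n|^t}\sum_{u\in B_n}\omega_u(x)>0\Big\},\qquad U_t=\Big\{x:\limsup_{n\to\infty}\tfrac{1}{|B_n|^t}\sum_{u\in B_n}\omega_u(x)=0\Big\}.$$ The lower critical dimension is $\alpha(B_n)=\sup\{t:\mu(L_t)=1\}$ and the upper critical dimension is $\beta(B_n)=\inf\{t:\mu(U_t)=1\}$. Metric isomorphism: two non-singular actions on $(X,\mu)$ and $(Y,\nu)$ are metrically isomorphic if there are invariant sets of full measure $X_0\subseteq X$, $Y_0\subseteq Y$ and a bimeasurable bijection $\theta:X_0\to Y_0$ with $\theta(ux)=u\,\theta(x)$ for all $u\in\mathbb{Z}^d$, $x\in X_0$, and $\nu\circ\theta\sim\mu$ (equivalence of measures, not necessarily equality). Rectangular metric: a metric on $\mathbb{Z}^d$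 of the form $\rho(u,v)=\max_{1\le i\le d}F_i(|u_i-v_i|)$, where each $F_i:[0,\infty)\to[0,\infty)$ satisfies $F_i(0)=0$, is subadditive and strictly increasing, and has an inverse $f_i:[0,\infty)\to[0,\infty)$ (i.e. $F_i$ is a bijection of $[0,\infty)$). Then $B_n=\prod_{i=1}^d[-\lfloor f_i(n)\rfloor,\lfloor f_i(n)\rfloor]$ (a product of sets of integers). *)

theory Defs
  imports "HOL-Probability.Probability"
begin

definition standard_borel_space :: "'a measure \<Rightarrow> bool" where
  "standard_borel_space M \<longleftrightarrow>
     (\<exists>X. completely_metrizable_space X \<and> separable_space X \<and> topspace X = space M \<and>
          sets M = sigma_sets (topspace X) {U. openin X U})"

definition standard_prob_space :: "'a measure \<Rightarrow> bool" where
  "standard_prob_space M \<longleftrightarrow> prob_space M \<and> standard_borel_space M"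

definition equivalent_measures :: "'a measure \<Rightarrow> 'a measure \<Rightarrow> bool" where
  "equivalent_measures M N \<longleftrightarrow>
     sets M = sets N \<and> absolutely_continuous M N \<and> absolutely_continuous N M"

text \<open>
  The group \<open>\<int>\<^sup>d\<close> is the additive group \<open>int ^ 'd\<close>, with \<open>d = CARD('d)\<close>.
  The measure \<open>\<mu> \<circ> u\<close> sends \<open>A\<close> to \<open>\<mu> (u A)\<close>; as \<open>u A\<close> is the preimage of \<open>A\<close>
  under the action of \<open>- u\<close>, this is the push-forward of \<open>\<mu>\<close> along \<open>- u\<close>.
\<close>

definition translated_measure ::
  "'a measure \<Rightarrow> (int ^ 'd \<Rightarrow> 'a \<Rightarrow> 'a) \<Rightarrow> int ^ 'd \<Rightarrow> 'a measure" where
  "translated_measure M T u = distr M M (T (- u))"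

locale measurable_action =
  fixes M :: "'a measure" and T :: "int ^ 'd \<Rightarrow> 'a \<Rightarrow> 'a"
  assumes action_measurable: "\<And>u. T u \<in> measurable M M"
    and action_zero: "\<And>x. x \<in> space M \<Longrightarrow> T 0 x = x"
    and action_add: "\<And>u v x. x \<in> space M \<Longrightarrow> T (u + v) x = T u (T v x)"

locale nonsingular_action = measurable_action +
  assumes nonsingular: "\<And>u. equivalent_measures (translated_measure M T u) M"

definition invariant_set :: "(int ^ 'd \<Rightarrow> 'a \<Rightarrow> 'a) \<Rightarrow> 'a set \<Rightarrow> bool" where
  "invariant_set T A \<longleftrightarrow> (\<forall>u. T u ` A = A)"

definition ergodic_action :: "'a measure \<Rightarrow> (int ^ 'd \<Rightarrow> 'a \<Rightarrow> 'a) \<Rightarrow> bool" where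
  "ergodic_action M T \<longleftrightarrow>
     (\<forall>A\<in>sets M. invariant_set T A \<longrightarrow> emeasure M A = 0 \<or> emeasure M (space M - A) = 0)"

definition cocycle ::
  "'a measure \<Rightarrow> (int ^ 'd \<Rightarrow> 'a \<Rightarrow> 'a) \<Rightarrow> int ^ 'd \<Rightarrow> 'a \<Rightarrow> ennreal" where
  "cocycle M T u = RN_deriv M (translated_measure M T u)"

definition normalized_sum ::
  "'a measure \<Rightarrow> (int ^ 'd \<Rightarrow> 'a \<Rightarrow> 'a) \<Rightarrow> (nat \<Rightarrow> (int ^ 'd) set) \<Rightarrow> real \<Rightarrow> nat \<Rightarrow> 'a \<Rightarrow> ennreal" where
  "normalized_sum M T B t n x =
     (\<Sum>u\<in>B n. cocycle M T u x) / ennreal (real (card (B n)) powr t)"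

definition lower_set ::
  "'a measure \<Rightarrow> (int ^ 'd \<Rightarrow> 'a \<Rightarrow> 'a) \<Rightarrow> (nat \<Rightarrow> (int ^ 'd) set) \<Rightarrow> real \<Rightarrow> 'a set" where
  "lower_set M T B t = {x \<in> space M. liminf (\<lambda>n. normalized_sum M T B t n x) > 0}"

definition upper_set ::
  "'a measure \<Rightarrow> (int ^ 'd \<Rightarrow> 'a \<Rightarrow> 'a) \<Rightarrow> (nat \<Rightarrow> (int ^ 'd) set) \<Rightarrow> real \<Rightarrow> 'a set" where
  "upper_set M T B t = {x \<in> space M. limsup (\<lambda>n. normalized_sum M T B t n x) = 0}"

text \<open>The critical dimensions are taken in \<open>ereal\<close>, so that Sup and Inf are never junk values.\<close>

definition lower_critical_dimension ::
  "'a measure \<Rightarrow> (int ^ 'd \<Rightarrow> 'a \<Rightarrow> 'a) \<Rightarrow> (nat \<Rightarrow> (int ^ 'd) set) \<Rightarrow> ereal" where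
  "lower_critical_dimension M T B = Sup (ereal ` {t. emeasure M (lower_set M T B t) = 1})"

definition upper_critical_dimension ::
  "'a measure \<Rightarrow> (int ^ 'd \<Rightarrow> 'a \<Rightarrow> 'a) \<Rightarrow> (nat \<Rightarrow> (int ^ 'd) set) \<Rightarrow> ereal" where
  "upper_critical_dimension M T B = Inf (ereal ` {t. emeasure M (upper_set M T B t) = 1})"

text \<open>
  The last conjunct states \<open>\<nu> \<circ> \<theta> \<sim> \<mu>\<close> on \<open>X\<^sub>0\<close>: the measure \<open>A \<mapsto> \<nu> (\<theta> A)\<close> is the
  push-forward of \<open>\<nu>\<close> along the inverse of \<open>\<theta>\<close>.
\<close>

definition metrically_isomorphic ::
  "'a measure \<Rightarrow> (int ^ 'd \<Rightarrow> 'a \<Rightarrow> 'a) \<Rightarrow> 'b measure \<Rightarrow> (int ^ 'd \<Rightarrow> 'b \<Rightarrow> 'b) \<Rightarrow> bool" where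
  "metrically_isomorphic M T N S \<longleftrightarrow>
     (\<exists>X0\<in>sets M. \<exists>Y0\<in>sets N. \<exists>\<theta>.
        invariant_set T X0 \<and> emeasure M (space M - X0) = 0 \<and>
        invariant_set S Y0 \<and> emeasure N (space N - Y0) = 0 \<and>
        bij_betw \<theta> X0 Y0 \<and>
        \<theta> \<in> measurable (restrict_space M X0) (restrict_space N Y0) \<and>
        the_inv_into X0 \<theta> \<in> measurable (restrict_space N Y0) (restrict_space M X0) \<and>
        (\<forall>u. \<forall>x\<in>X0. \<theta> (T u x) = S u (\<theta> x)) \<and>
        equivalent_measures
          (distr (restrict_space N Y0) (restrict_space M X0) (the_inv_into X0 \<theta>))
          (restrict_space M X0))"

definition rectangular_metric :: "(int ^ 'd \<Rightarrow> int ^ 'd \<Rightarrow> real) \<Rightarrow> bool" where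
  "rectangular_metric \<rho> \<longleftrightarrow>
     Metric_space UNIV \<rho> \<and>
     (\<exists>F :: 'd \<Rightarrow> real \<Rightarrow> real.
        (\<forall>i. F i 0 = 0 \<and>
             (\<forall>x\<ge>0. \<forall>y\<ge>0. F i (x + y) \<le> F i x + F i y) \<and>
             strict_mono_on {0..} (F i) \<and>
             bij_betw (F i) {0..} {0..}) \<and>
        (\<forall>u v. \<rho> u v = Max (range (\<lambda>i. F i (real_of_int \<bar>u $ i - v $ i\<bar>)))))"

end

theory Submission
  imports Defs
begin

text \<open>
  Transporting \<open>\<nu>\<close> to \<open>X\<close> reduces the claim to two equivalent probabilities \<open>\<mu>\<close> and \<open>\<mu>' = h \<mu>\<close>
  under one action. Their cocycles satisfy \<open>h(x) \<omega>'\<^sub>u(x) = h(u x) \<omega>\<^sub>u(x)\<close>, so with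
  \<open>S\<^sub>n = \<Sum>\<^bsub>u \<in> B\<^sub>n\<^esub> \<omega>\<^sub>u\<close> the quantity to control is
  \<open>R\<^sub>n(x) = (\<Sum>\<^bsub>u \<in> B\<^sub>n\<^esub> h(u x) \<omega>\<^sub>u(x)) / S\<^sub>n(x) = h(x) S'\<^sub>n(x) / S\<^sub>n(x)\<close>.
  Neither a ratio ergodic theorem nor a covering lemma is needed. A change of variables and the
  cocycle identity give
  \<open>\<integral> R\<^sub>n d\<mu> = \<integral> h(y) \<Sum>\<^bsub>u \<in> B\<^sub>n\<^esub> \<omega>\<^bsub>-u\<^esub>(y) / (\<Sum>\<^bsub>v \<in> B\<^sub>n\<^esub> \<omega>\<^bsub>v-u\<^esub>(y)) d\<mu>(y)\<close>.
  Two points of \<open>B\<^sub>n\<close> in the same orthant differ by a point of \<open>B\<^sub>n\<close>, so each of the \<open>2\<^sup>d\<close>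
  orthants contributes at most \<open>1\<close> to the inner sum, and \<open>\<integral> R\<^sub>n d\<mu> \<le> 2\<^sup>d\<close> for every \<open>n\<close>.

  Choose one \<open>n\<^sub>j\<close> for each dyadic range \<open>2\<^sup>j \<le> |B\<^sub>n| < 2\<^bsup>j+1\<^esup>\<close>. Then
  \<open>\<Sum>\<^sub>j 2\<^bsup>-\<epsilon>j\<^esup> R\<^bsub>n\<^sub>j\<^esub>\<close> is integrable, hence finite almost everywhere, that is
  \<open>S'\<^sub>n \<le> C(x) |B\<^sub>n|\<^sup>\<epsilon> S\<^sub>n\<close> along \<open>n = n\<^sub>j\<close>. Taking \<open>n\<^sub>j\<close> to be the last (respectively first) index of
  its range, monotonicity in \<open>n\<close> carries the growth bounds over to all \<open>n\<close>. The loss of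
  \<open>|B\<^sub>n|\<^sup>\<epsilon>\<close> does not affect the supremum and infimum defining the critical dimensions.
\<close>

subsection \<open>Non-singular actions and their cocycles\<close>

locale nonsingular_prob_action = nonsingular_action M T + prob_space M
  for M :: "'a measure" and T :: "int ^ 'd \<Rightarrow> 'a \<Rightarrow> 'a"
begin

lemma action_measurable' [measurable]: "T u \<in> measurable M M"
  by (rule action_measurable)

lemma action_uminus: "x \<in> space M \<Longrightarrow> T u (T (- u) x) = x" "x \<in> space M \<Longrightarrow> T (- u) (T u x) = x"
  using action_add[of x u "- u"] action_add[of x "- u" u] action_zero by simp_all

lemma cocycle_measurable [measurable]: "cocycle M T u \<in> borel_measurable M"
  unfolding cocycle_def by simp

lemma density_cocycle: "density M (cocycle M T u) = translated_measure M T u"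
  using nonsingular[of u] unfolding cocycle_def equivalent_measures_def
  by (intro density_RN_deriv) auto

lemma nn_integral_cocycle:
  assumes [measurable]: "f \<in> borel_measurable M"
  shows "(\<integral>\<^sup>+x. f (T u x) * cocycle M T u x \<partial>M) = (\<integral>\<^sup>+x. f x \<partial>M)"
proof -
  have "(\<integral>\<^sup>+x. f (T u x) * cocycle M T u x \<partial>M) = (\<integral>\<^sup>+x. f (T u x) \<partial>density M (cocycle M T u))"
    by (simp add: nn_integral_density mult.commute)
  also have "\<dots> = (\<integral>\<^sup>+x. f (T u (T (- u) x)) \<partial>M)"
    unfolding density_cocycle translated_measure_def by (subst nn_integral_distr) auto
  also have "\<dots> = (\<integral>\<^sup>+x. f x \<partial>M)"
    by (intro nn_integral_cong) (simp add: action_uminus)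
  finally show ?thesis .
qed

text \<open>Turns every later cocycle identity (chain rule, change of measure, transport) into an
  integral identity. Testing with \<open>indicator A\<close> composed with \<open>T (- u)\<close>
  recovers the push-forward measure, and uniqueness of Radon-Nikodym derivatives finishes.\<close>

lemma cocycle_unique:
  assumes [measurable]: "g \<in> borel_measurable M"
    and g: "\<And>f. f \<in> borel_measurable M \<Longrightarrow> (\<integral>\<^sup>+x. f (T u x) * g x \<partial>M) = (\<integral>\<^sup>+x. f x \<partial>M)"
  shows "AE x in M. g x = cocycle M T u x"
  unfolding cocycle_def
proof (rule RN_deriv_unique)
  show "density M g = translated_measure M T u"
  proof (rule measure_eqI)
    fix A assume "A \<in> sets (density M g)"
    then have [measurable]: "A \<in> sets M" by simp
    have "emeasure (density M g) A = (\<integral>\<^sup>+x. indicator A (T (- u) (T u x)) * g x \<partial>M)"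
      by (auto simp: emeasure_density mult.commute action_uminus intro!: nn_integral_cong)
    also have "\<dots> = (\<integral>\<^sup>+x. indicator A (T (- u) x) \<partial>M)"
      by (rule g) measurable
    also have "\<dots> = (\<integral>\<^sup>+x. indicator A x \<partial>translated_measure M T u)"
      unfolding translated_measure_def by (subst nn_integral_distr) auto
    also have "\<dots> = emeasure (translated_measure M T u) A"
      by (simp add: translated_measure_def)
    finally show "emeasure (density M g) A = emeasure (translated_measure M T u) A" .
  qed (simp add: translated_measure_def)
qed simp

text \<open>The product passes the test of \<open>cocycle_unique\<close>: change variables along
  \<open>v\<close>, then along \<open>u\<close>.\<close>

lemma AE_cocycle_add:
  "AE x in M. cocycle M T u (T v x) * cocycle M T v x = cocycle M T (u + v) x"
proof (rule cocycle_unique)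
  fix f :: "'a \<Rightarrow> ennreal" assume [measurable]: "f \<in> borel_measurable M"
  have "(\<integral>\<^sup>+x. f (T (u + v) x) * (cocycle M T u (T v x) * cocycle M T v x) \<partial>M)
    = (\<integral>\<^sup>+x. (\<lambda>y. f (T u y) * cocycle M T u y) (T v x) * cocycle M T v x \<partial>M)"
    by (intro nn_integral_cong) (simp add: action_add mult.assoc)
  also have "\<dots> = (\<integral>\<^sup>+x. f (T u x) * cocycle M T u x \<partial>M)"
    by (rule nn_integral_cocycle) measurable
  also have "\<dots> = (\<integral>\<^sup>+x. f x \<partial>M)"
    by (rule nn_integral_cocycle) measurable
  finally show "(\<integral>\<^sup>+x. f (T (u + v) x) * (cocycle M T u (T v x) * cocycle M T v x) \<partial>M)
    = (\<integral>\<^sup>+x. f x \<partial>M)" .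
qed measurable

lemma AE_cocycle_zero: "AE x in M. cocycle M T 0 x = 1"
proof -
  have "AE x in M. (\<lambda>_. 1) x = cocycle M T 0 x"
    by (rule cocycle_unique) (auto simp: action_zero intro!: nn_integral_cong)
  then show ?thesis by eventually_elim simp
qed

text \<open>Finite because its integral is 1; nonzero because the chain rule for \<open>- u\<close>
  and \<open>u\<close> makes it a factor of 1.\<close>

lemma AE_cocycle_pos_finite: "AE x in M. cocycle M T u x \<noteq> 0 \<and> cocycle M T u x \<noteq> \<infinity>"
proof -
  have "(\<integral>\<^sup>+x. cocycle M T u x \<partial>M) = 1"
    using nn_integral_cocycle[of "\<lambda>_. 1" u] by (simp add: emeasure_space_1)
  then have "AE x in M. cocycle M T u x \<noteq> \<infinity>"
    by (intro nn_integral_PInf_AE) auto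
  with AE_cocycle_add[of "- u" u] AE_cocycle_zero show ?thesis
    by eventually_elim auto
qed

end

subsection \<open>An averaged ratio bound at a single scale\<close>

definition orbit_sum :: "'a measure \<Rightarrow> (int ^ 'd \<Rightarrow> 'a \<Rightarrow> 'a) \<Rightarrow> (int ^ 'd) set \<Rightarrow> 'a \<Rightarrow> ennreal" where
  "orbit_sum M T A x = (\<Sum>u\<in>A. cocycle M T u x)"

lemma ennreal_inverse_antimono:
  fixes x y :: ennreal
  assumes "x \<le> y"
  shows "inverse y \<le> inverse x"
proof (cases "x = 0 \<or> y = top")
  case False
  with assms have "0 < x" "x < top" "0 < y" "y < top"
    by (auto simp: zero_less_iff_neq_zero top.not_eq_extremum intro: le_less_trans)
  then obtain a b where "0 < a" "0 < b" "x = ennreal a" "y = ennreal b"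
    by (auto simp: less_top_ennreal)
  with assms show ?thesis
    by (simp add: inverse_ennreal le_imp_inverse_le)
qed auto

text \<open>
  Restricted to one fibre of \<open>c\<close>, every denominator contains the sum of all numerators, so each
  fibre contributes at most \<open>1\<close>. For boxes, \<open>c\<close> will record the orthant of a point.
\<close>
lemma sum_divide_sum_differences_le:
  fixes w :: "'g::ab_group_add \<Rightarrow> ennreal" and c :: "'g \<Rightarrow> 'k::finite"
  assumes fin: "finite A"
    and diff: "\<And>u v. u \<in> A \<Longrightarrow> v \<in> A \<Longrightarrow> c u = c v \<Longrightarrow> u - v \<in> A"
  shows "(\<Sum>u\<in>A. w (- u) / (\<Sum>v\<in>A. w (v - u))) \<le> of_nat CARD('k)"
proof -
  have fib: "(\<Sum>u\<in>{u\<in>A. c u = k}. w (- u) / (\<Sum>v\<in>A. w (v - u))) \<le> 1" for k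
  proof -
    let ?W = "\<Sum>v\<in>{v\<in>A. c v = k}. w (- v)"
    have le: "?W \<le> (\<Sum>v\<in>A. w (v - u))" if u: "u \<in> A" "c u = k" for u
    proof -
      have "?W = (\<Sum>v\<in>(\<lambda>v. u - v) ` {v\<in>A. c v = k}. w (v - u))"
        by (subst sum.reindex) (auto simp: inj_on_def)
      also have "\<dots> \<le> (\<Sum>v\<in>A. w (v - u))"
        using u diff fin by (intro sum_mono2) auto
      finally show ?thesis .
    qed
    have "(\<Sum>u\<in>{u\<in>A. c u = k}. w (- u) / (\<Sum>v\<in>A. w (v - u))) \<le> (\<Sum>u\<in>{u\<in>A. c u = k}. w (- u) / ?W)"
      unfolding divide_ennreal_def by (intro sum_mono mult_left_mono ennreal_inverse_antimono le) auto
    also have "\<dots> = ?W / ?W"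
      by (simp add: divide_ennreal_def sum_distrib_right)
    also have "\<dots> \<le> 1"
      by (cases "?W = 0 \<or> ?W = \<infinity>") (auto simp: ennreal_divide_self top.not_eq_extremum)
    finally show ?thesis .
  qed
  have "(\<Sum>u\<in>A. w (- u) / (\<Sum>v\<in>A. w (v - u)))
    = (\<Sum>k\<in>UNIV. \<Sum>u\<in>{u\<in>A. c u = k}. w (- u) / (\<Sum>v\<in>A. w (v - u)))"
    using fin by (intro sum.group[symmetric]) auto
  also have "\<dots> \<le> (\<Sum>k\<in>(UNIV::'k set). 1)"
    by (intro sum_mono fib)
  finally show ?thesis by simp
qed

context nonsingular_prob_action
begin

lemma orbit_sum_measurable [measurable]: "orbit_sum M T A \<in> borel_measurable M"
  unfolding orbit_sum_def[abs_def] by measurable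

text \<open>Changing variables by \<open>- u\<close> in each summand frees \<open>h\<close> from its
  dependence on \<open>u\<close>. What multiplies \<open>h\<close> is then a sum of reciprocals that
  the colouring \<open>c\<close> bounds pointwise, whatever \<open>h\<close> is.\<close>

lemma nn_integral_weighted_ratio_le:
  fixes c :: "int ^ 'd \<Rightarrow> 'k::finite"
  assumes fin: "finite A"
    and diff: "\<And>u v. u \<in> A \<Longrightarrow> v \<in> A \<Longrightarrow> c u = c v \<Longrightarrow> u - v \<in> A"
    and [measurable]: "h \<in> borel_measurable M"
  shows "(\<integral>\<^sup>+x. (\<Sum>u\<in>A. h (T u x) * cocycle M T u x) / orbit_sum M T A x \<partial>M)
           \<le> of_nat CARD('k) * (\<integral>\<^sup>+x. h x \<partial>M)"
proof -
  have summand: "(\<integral>\<^sup>+x. h (T u x) * cocycle M T u x / orbit_sum M T A x \<partial>M)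
      = (\<integral>\<^sup>+x. h x / orbit_sum M T A (T (- u) x) \<partial>M)" for u
  proof -
    have "(\<integral>\<^sup>+x. h (T u x) * cocycle M T u x / orbit_sum M T A x \<partial>M)
      = (\<integral>\<^sup>+x. (\<lambda>y. h y / orbit_sum M T A (T (- u) y)) (T u x) * cocycle M T u x \<partial>M)"
      by (intro nn_integral_cong) (simp add: action_uminus divide_ennreal_def mult_ac)
    also have "\<dots> = (\<integral>\<^sup>+x. h x / orbit_sum M T A (T (- u) x) \<partial>M)"
      by (rule nn_integral_cocycle) measurable
    finally show ?thesis .
  qed
  have "AE x in M. \<forall>u\<in>A. cocycle M T (- u) x \<noteq> 0 \<and> cocycle M T (- u) x \<noteq> \<infinity>"
    using fin by (intro AE_finite_allI AE_cocycle_pos_finite)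
  moreover have "AE x in M. \<forall>u\<in>A. \<forall>v\<in>A.
      cocycle M T v (T (- u) x) * cocycle M T (- u) x = cocycle M T (v + - u) x"
    using fin by (intro AE_finite_allI AE_cocycle_add)
  ultimately have bound: "AE x in M. (\<Sum>u\<in>A. 1 / orbit_sum M T A (T (- u) x)) \<le> of_nat CARD('k)"
  proof eventually_elim
    case (elim x)
    \<comment> \<open>The chain rule pulls the denominator back to \<open>x\<close>; expanding the
      fraction by \<open>cocycle M T (- u) x\<close> is legitimate since this factor is neither zero
      nor infinite.\<close>
    have "1 / orbit_sum M T A (T (- u) x) = cocycle M T (- u) x / (\<Sum>v\<in>A. cocycle M T (v - u) x)"
      if u: "u \<in> A" for u
    proof -
      have "(\<Sum>v\<in>A. cocycle M T (v - u) x) = orbit_sum M T A (T (- u) x) * cocycle M T (- u) x"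
        using elim(2) u by (simp add: orbit_sum_def sum_distrib_right)
      then show ?thesis
        using divide_mult_eq[of "cocycle M T (- u) x" 1 "orbit_sum M T A (T (- u) x)"] elim(1) u by simp
    qed
    then have "(\<Sum>u\<in>A. 1 / orbit_sum M T A (T (- u) x))
        = (\<Sum>u\<in>A. cocycle M T (- u) x / (\<Sum>v\<in>A. cocycle M T (v - u) x))"
      by (intro sum.cong) auto
    also have "\<dots> \<le> of_nat CARD('k)"
      using fin diff by (rule sum_divide_sum_differences_le)
    finally show ?case .
  qed
  have "(\<integral>\<^sup>+x. (\<Sum>u\<in>A. h (T u x) * cocycle M T u x) / orbit_sum M T A x \<partial>M)
    = (\<Sum>u\<in>A. \<integral>\<^sup>+x. h (T u x) * cocycle M T u x / orbit_sum M T A x \<partial>M)"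
    by (subst nn_integral_sum[symmetric]) (auto simp: divide_ennreal_def sum_distrib_right)
  also have "\<dots> = (\<integral>\<^sup>+x. h x * (\<Sum>u\<in>A. 1 / orbit_sum M T A (T (- u) x)) \<partial>M)"
    unfolding summand
    by (subst nn_integral_sum[symmetric]) (auto simp: divide_ennreal_def sum_distrib_left)
  also have "\<dots> \<le> (\<integral>\<^sup>+x. h x * of_nat CARD('k) \<partial>M)"
    using bound by (intro nn_integral_mono_AE) (auto elim!: eventually_mono intro: mult_left_mono)
  also have "\<dots> = of_nat CARD('k) * (\<integral>\<^sup>+x. h x \<partial>M)"
    by (simp add: nn_integral_multc mult.commute)
  finally show ?thesis .
qed

end

subsection \<open>Change of measure\<close>

lemma AE_cong_equivalent_measures:
  assumes "equivalent_measures M' M"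
  shows "(AE x in M'. P x) \<longleftrightarrow> (AE x in M. P x)"
  using assms absolutely_continuous_AE[of M M' P] absolutely_continuous_AE[of M' M P]
  by (auto simp: equivalent_measures_def)

text \<open>Non-singularity depends on the measure through its null sets alone, and equivalent
  measures share these.\<close>

lemma nonsingular_action_equivalent_measure:
  assumes "nonsingular_action M T" and eq: "equivalent_measures M' M"
  shows "nonsingular_action M' T"
proof -
  interpret nonsingular_action M T by fact
  have sets: "sets M' = sets M" and null: "null_sets M' = null_sets M"
    using eq by (auto simp: equivalent_measures_def absolutely_continuous_def)
  have space: "space M' = space M" using sets by (rule sets_eq_imp_space_eq)
  have meas: "T u \<in> measurable M' M'" for u
    using action_measurable[of u] measurable_cong_sets[OF sets sets] by simp
  show ?thesis
  proof
    fix u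
    have "null_sets (translated_measure M' T u) = null_sets M'"
    proof -
      have "null_sets (distr M' M' (T (- u))) = null_sets (distr M M (T (- u)))"
        using sets null space meas[of "- u"] action_measurable[of "- u"]
        by (auto simp: null_sets_distr_iff)
      then show ?thesis
        using nonsingular[of u] null
        by (auto simp: translated_measure_def equivalent_measures_def absolutely_continuous_def)
    qed
    then show "equivalent_measures (translated_measure M' T u) M'"
      by (simp add: equivalent_measures_def absolutely_continuous_def)
        (simp add: translated_measure_def)
  qed (use meas space action_zero action_add in auto)
qed

locale equivalent_actions =
  nonsingular_prob_action M T + M': nonsingular_prob_action M' T
  for M M' :: "'a measure" and T :: "int ^ 'd \<Rightarrow> 'a \<Rightarrow> 'a" +
  assumes equivalent: "equivalent_measures M' M"
begin

lemma sets_M' [simp, measurable_cong]: "sets M' = sets M"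
  using equivalent by (simp add: equivalent_measures_def)

lemma space_M' [simp]: "space M' = space M"
  by (rule sets_eq_imp_space_eq) simp

lemma density_RN_deriv_M': "density M (RN_deriv M M') = M'"
  using equivalent by (intro density_RN_deriv) (auto simp: equivalent_measures_def)

lemma AE_RN_deriv_M': "AE x in M. RN_deriv M M' x \<noteq> 0 \<and> RN_deriv M M' x \<noteq> \<infinity>"
proof -
  have "AE x in density M (RN_deriv M M'). RN_deriv M M' x \<noteq> 0"
    by (subst AE_density) auto
  then have "AE x in M. RN_deriv M M' x \<noteq> 0"
    unfolding density_RN_deriv_M' AE_cong_equivalent_measures[OF equivalent] .
  moreover have "AE x in M. RN_deriv M M' x \<noteq> \<infinity>"
    using equivalent
    by (intro RN_deriv_finite M'.sigma_finite_measure_axioms) (auto simp: equivalent_measures_def)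
  ultimately show ?thesis by eventually_elim simp
qed

text \<open>The quotient obtained by solving for \<open>cocycle M' T u x\<close> satisfies the
  change of variables formula for \<open>M'\<close>: the density of \<open>M'\<close> cancels its
  denominator and leaves the formula for \<open>M\<close>.\<close>

lemma AE_cocycle_change_of_measure:
  "AE x in M. RN_deriv M M' x * cocycle M' T u x = RN_deriv M M' (T u x) * cocycle M T u x"
proof -
  let ?h = "RN_deriv M M'"
  have "AE x in M'. ?h (T u x) * cocycle M T u x / ?h x = cocycle M' T u x"
  proof (rule M'.cocycle_unique)
    fix f :: "'a \<Rightarrow> ennreal" assume "f \<in> borel_measurable M'"
    then have [measurable]: "f \<in> borel_measurable M" by simp
    have "(\<integral>\<^sup>+x. f (T u x) * (?h (T u x) * cocycle M T u x / ?h x) \<partial>density M ?h)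
      = (\<integral>\<^sup>+x. ?h x * (f (T u x) * (?h (T u x) * cocycle M T u x / ?h x)) \<partial>M)"
      by (rule nn_integral_density) measurable
    also have "\<dots> = (\<integral>\<^sup>+x. (\<lambda>y. f y * ?h y) (T u x) * cocycle M T u x \<partial>M)"
    proof (rule nn_integral_cong_AE)
      show "AE x in M. ?h x * (f (T u x) * (?h (T u x) * cocycle M T u x / ?h x))
        = (\<lambda>y. f y * ?h y) (T u x) * cocycle M T u x"
        using AE_RN_deriv_M'
      proof eventually_elim
        case (elim x)
        then have "?h x * inverse (?h x) = 1"
          using ennreal_divide_self[of "?h x"] by (simp add: divide_ennreal_def top.not_eq_extremum)
        moreover have "?h x * (f (T u x) * (?h (T u x) * cocycle M T u x / ?h x))
          = (?h x * inverse (?h x)) * (f (T u x) * ?h (T u x) * cocycle M T u x)"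
          by (simp only: divide_ennreal_def mult_ac)
        ultimately show ?case by simp
      qed
    qed
    also have "\<dots> = (\<integral>\<^sup>+x. f x * ?h x \<partial>M)"
      by (rule nn_integral_cocycle) measurable
    also have "\<dots> = (\<integral>\<^sup>+x. f x \<partial>density M ?h)"
      by (simp add: nn_integral_density mult.commute)
    finally show "(\<integral>\<^sup>+x. f (T u x) * (?h (T u x) * cocycle M T u x / ?h x) \<partial>M') = (\<integral>\<^sup>+x. f x \<partial>M')"
      unfolding density_RN_deriv_M' .
  qed measurable
  then have "AE x in M. ?h (T u x) * cocycle M T u x / ?h x = cocycle M' T u x"
    unfolding AE_cong_equivalent_measures[OF equivalent] .
  with AE_RN_deriv_M' show ?thesis
  proof eventually_elim
    case (elim x)
    have "?h x * (?h (T u x) * cocycle M T u x / ?h x) = ?h (T u x) * cocycle M T u x"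
      using elim(1) by (simp add: ennreal_times_divide ennreal_mult_divide_eq mult.commute[of "?h x"])
    then show ?case using elim(2) by simp
  qed
qed

text \<open>Each scale is controlled only in mean. The weights \<open>q ^ j\<close> make the sum of
  all ratios integrable, so one finite \<open>C\<close>, depending on the point, serves all
  \<open>j\<close> at once.\<close>

lemma AE_orbit_sum_dominated:
  fixes c :: "int ^ 'd \<Rightarrow> 'k::finite" and A :: "nat \<Rightarrow> (int ^ 'd) set"
  assumes fin: "\<And>j. finite (A j)" and ne: "\<And>j. A j \<noteq> {}"
    and diff: "\<And>j u v. u \<in> A j \<Longrightarrow> v \<in> A j \<Longrightarrow> c u = c v \<Longrightarrow> u - v \<in> A j"
    and q: "0 < q" "q < 1"
  shows "AE x in M. \<exists>C>0. \<forall>j. ennreal (q ^ j) * orbit_sum M' T (A j) x \<le> ennreal C * orbit_sum M T (A j) x"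
proof -
  let ?h = "RN_deriv M M'"
  \<comment> \<open>By the change of measure this is the Radon-Nikodym derivative at
    \<open>x\<close> times the ratio of the two orbit sums; in the present form its integral is
    bounded by the single-scale estimate.\<close>
  define R where "R j x = (\<Sum>u\<in>A j. ?h (T u x) * cocycle M T u x) / orbit_sum M T (A j) x" for j x
  have [measurable]: "R j \<in> borel_measurable M" for j
    unfolding R_def by measurable
  define G where "G x = (\<Sum>j. ennreal (q ^ j) * R j x)" for x
  have [measurable]: "G \<in> borel_measurable M"
    unfolding G_def by measurable
  have h1: "(\<integral>\<^sup>+x. ?h x \<partial>M) = 1"
    using M'.emeasure_space_1 nn_integral_density[of ?h M "\<lambda>_. 1"]
    by (simp add: density_RN_deriv_M')
  have R: "(\<integral>\<^sup>+x. R j x \<partial>M) \<le> of_nat CARD('k)" for j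
  proof -
    have "(\<integral>\<^sup>+x. R j x \<partial>M) \<le> of_nat CARD('k) * (\<integral>\<^sup>+x. ?h x \<partial>M)"
      unfolding R_def by (rule nn_integral_weighted_ratio_le[where c = c]) (use fin diff in auto)
    then show ?thesis by (simp only: h1 mult_1_right)
  qed
  have geometric: "(\<Sum>j. ennreal (q ^ j)) = ennreal (1 / (1 - q))"
    using geometric_sums[of q] q by (intro suminf_ennreal_eq) simp_all
  have "(\<integral>\<^sup>+x. G x \<partial>M) = (\<Sum>j. ennreal (q ^ j) * (\<integral>\<^sup>+x. R j x \<partial>M))"
    unfolding G_def by (simp add: nn_integral_suminf nn_integral_cmult)
  also have "\<dots> \<le> (\<Sum>j. ennreal (q ^ j) * of_nat CARD('k))"
    by (intro suminf_le mult_left_mono R) auto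
  also have "\<dots> = ennreal (1 / (1 - q)) * of_nat CARD('k)"
    by (simp only: ennreal_suminf_multc geometric)
  also have "\<dots> < \<infinity>"
    by (simp add: ennreal_mult_less_top of_nat_less_top)
  finally have "AE x in M. G x \<noteq> \<infinity>"
    by (intro nn_integral_PInf_AE) auto
  moreover have "AE x in M. \<forall>j. \<forall>u\<in>A j. cocycle M T u x \<noteq> 0 \<and> cocycle M T u x \<noteq> \<infinity>"
    using fin by (intro AE_all_countable[THEN iffD2] allI AE_finite_allI AE_cocycle_pos_finite)
  moreover have "AE x in M. \<forall>j. \<forall>u\<in>A j. ?h x * cocycle M' T u x = ?h (T u x) * cocycle M T u x"
    using fin by (intro AE_all_countable[THEN iffD2] allI AE_finite_allI AE_cocycle_change_of_measure)
  ultimately show ?thesis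
    using AE_RN_deriv_M'
  proof eventually_elim
    case (elim x)
    have inv: "inverse (?h x) * ?h x = 1"
      using elim(4) ennreal_divide_self[of "?h x"]
      by (simp add: divide_ennreal_def top.not_eq_extremum mult.commute)
    have bound: "ennreal (q ^ j) * orbit_sum M' T (A j) x \<le> G x * inverse (?h x) * orbit_sum M T (A j) x" for j
    proof -
      have S: "orbit_sum M T (A j) x \<noteq> 0" "orbit_sum M T (A j) x \<noteq> \<infinity>"
        using elim(2) ne[of j] fin[of j] by (auto simp: orbit_sum_def)
      have "?h x * orbit_sum M' T (A j) x = (\<Sum>u\<in>A j. ?h (T u x) * cocycle M T u x)"
        using elim(3) by (simp add: orbit_sum_def sum_distrib_left)
      also have "\<dots> = R j x * orbit_sum M T (A j) x"
        unfolding R_def using S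
        by (simp add: ennreal_divide_times ennreal_times_divide ennreal_mult_divide_eq)
      finally have "?h x * orbit_sum M' T (A j) x = R j x * orbit_sum M T (A j) x" .
      moreover have "ennreal (q ^ j) * orbit_sum M' T (A j) x
        = ennreal (q ^ j) * (inverse (?h x) * (?h x * orbit_sum M' T (A j) x))"
        using inv by (simp add: mult.assoc[symmetric])
      ultimately have "ennreal (q ^ j) * orbit_sum M' T (A j) x
        = inverse (?h x) * (ennreal (q ^ j) * R j x) * orbit_sum M T (A j) x"
        by (simp only: mult_ac)
      also have "\<dots> \<le> inverse (?h x) * G x * orbit_sum M T (A j) x"
        unfolding G_def using sum_le_suminf[OF summableI, of "{j}" "\<lambda>j. ennreal (q ^ j) * R j x"]
        by (intro mult_right_mono mult_left_mono) auto
      finally show ?thesis by (simp add: mult.commute)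
    qed
    have "G x * inverse (?h x) < \<infinity>"
      using elim(1,4) by (simp add: ennreal_mult_eq_top_iff flip: top.not_eq_extremum)
    then obtain r where r: "0 \<le> r" "G x * inverse (?h x) = ennreal r"
      by (auto simp: less_top_ennreal)
    \<comment> \<open>\<open>r\<close> may be 0, while \<open>C\<close> must be positive; hence
      \<open>r + 1\<close>.\<close>
    show ?case
    proof (intro exI[of _ "r + 1"] conjI allI)
      fix j
      have "ennreal r * orbit_sum M T (A j) x \<le> ennreal (r + 1) * orbit_sum M T (A j) x"
        by (intro mult_right_mono ennreal_leI) auto
      then show "ennreal (q ^ j) * orbit_sum M' T (A j) x \<le> ennreal (r + 1) * orbit_sum M T (A j) x"
        using bound[of j] r by simp
    qed (use r in simp)
  qed
qed

end

subsection \<open>Interpolation between dyadic scales\<close>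

text \<open>For negative \<open>t\<close> the power is decreasing, so the comparison runs through
  reciprocals; the factor \<open>2 powr \<bar>t\<bar>\<close> covers both signs.\<close>

lemma powr_le_powr_of_comparable:
  fixes x y t :: real
  assumes "0 < x" "0 < y" "y \<le> 2 * x" "x \<le> 2 * y"
  shows "y powr t \<le> 2 powr \<bar>t\<bar> * x powr t"
proof (cases "t \<ge> 0")
  case True
  then have "y powr t \<le> (2 * x) powr t"
    using assms by (intro powr_mono2) auto
  then show ?thesis using True assms by (simp add: powr_mult)
next
  case False
  have "y powr t = (1 / y) powr (- t)"
    using assms by (simp add: powr_divide powr_minus_divide)
  also have "\<dots> \<le> (2 / x) powr (- t)"
    using assms False by (intro powr_mono2) (auto simp: field_simps)
  also have "\<dots> = 2 powr \<bar>t\<bar> * x powr t"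
    using assms False by (simp add: powr_divide powr_minus_divide)
  finally show ?thesis .
qed

lemma ennreal_divide_le_iff:
  fixes a :: ennreal
  assumes "0 < r"
  shows "a / ennreal r \<le> c \<longleftrightarrow> a \<le> c * ennreal r"
proof
  assume "a / ennreal r \<le> c"
  then have "a / ennreal r * ennreal r \<le> c * ennreal r" by (rule mult_right_mono) simp
  then show "a \<le> c * ennreal r"
    using assms by (simp add: ennreal_divide_times)
next
  assume "a \<le> c * ennreal r"
  then show "a / ennreal r \<le> c"
    using assms by (intro divide_le_posI_ennreal) (auto simp: mult.commute)
qed

lemma le_ennreal_divide_iff:
  fixes a :: ennreal
  assumes "0 < r"
  shows "c \<le> a / ennreal r \<longleftrightarrow> c * ennreal r \<le> a"
proof
  assume "c \<le> a / ennreal r"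
  then have "c * ennreal r \<le> a / ennreal r * ennreal r" by (rule mult_right_mono) simp
  then show "c * ennreal r \<le> a"
    using assms by (simp add: ennreal_divide_times)
next
  assume "c * ennreal r \<le> a"
  then have "c * ennreal r / ennreal r \<le> a / ennreal r" by (rule divide_right_mono_ennreal)
  then show "c \<le> a / ennreal r"
    using assms by (simp add: ennreal_mult_divide_eq)
qed

text \<open>Everything starts at 1 because the balls prescribe \<open>B n\<close> for positive
  \<open>n\<close> only; \<open>b 0\<close> is arbitrary.\<close>

locale growing_counts =
  fixes b :: "nat \<Rightarrow> nat"
  assumes count_pos: "1 \<le> n \<Longrightarrow> 1 \<le> b n"
    and count_mono: "1 \<le> m \<Longrightarrow> m \<le> n \<Longrightarrow> b m \<le> b n"
    and count_at_top: "filterlim b at_top sequentially"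
begin

text \<open>The element \<open>1\<close> is inserted so that \<open>dyadic_last j \<ge> 1\<close> even if no \<open>n\<close> has \<open>b n < 2 ^ (j + 1)\<close>.\<close>
definition dyadic_last :: "nat \<Rightarrow> nat" where
  "dyadic_last j = Max (insert 1 {n. b n < 2 ^ (j + 1)})"

text \<open>The counts may jump over a whole dyadic range; several \<open>j\<close> then share one
  index. The transfer below picks a \<open>j\<close> whose range contains the count of the given
  \<open>n\<close>.\<close>

definition dyadic_first :: "nat \<Rightarrow> nat" where
  "dyadic_first j = (LEAST n. 1 \<le> n \<and> 2 ^ j \<le> b n)"

lemma eventually_count_ge: "eventually (\<lambda>n. k \<le> b n) sequentially"
  using count_at_top by (simp add: filterlim_at_top)

lemma finite_count_less: "finite {n. b n < k}"
proof -
  obtain m where "\<And>n. m \<le> n \<Longrightarrow> k \<le> b n"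
    using eventually_count_ge[of k] by (auto simp: eventually_sequentially)
  then have "{n. b n < k} \<subseteq> {..<m}"
    by (auto simp: not_le[symmetric])
  then show ?thesis by (rule finite_subset) simp
qed

lemma dyadic_last_ge_1: "1 \<le> dyadic_last j"
  unfolding dyadic_last_def using finite_count_less by (intro Max_ge) auto

lemma dyadic_last:
  assumes "1 \<le> n" "b n < 2 ^ (j + 1)"
  shows "n \<le> dyadic_last j" "b (dyadic_last j) < 2 ^ (j + 1)"
proof -
  let ?X = "insert 1 {n. b n < 2 ^ (j + 1)}"
  show n: "n \<le> dyadic_last j"
    unfolding dyadic_last_def using assms finite_count_less by (intro Max_ge) auto
  have "dyadic_last j \<in> ?X"
    unfolding dyadic_last_def using finite_count_less by (intro Max_in) auto
  \<comment> \<open>If the maximum is the inserted 1, then \<open>n\<close> is 1 as well, and the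
    bound is the assumption on \<open>b n\<close>.\<close>
  then show "b (dyadic_last j) < 2 ^ (j + 1)"
    using n assms le_antisym[of n 1] by auto
qed

lemma dyadic_first: "1 \<le> dyadic_first j" "2 ^ j \<le> b (dyadic_first j)"
proof -
  have "\<exists>n. 1 \<le> n \<and> 2 ^ j \<le> b n"
    using eventually_conj[OF eventually_ge_at_top[of 1] eventually_count_ge[of "2 ^ j"]]
    by (rule eventually_happens'[rotated]) simp
  from LeastI_ex[OF this] show "1 \<le> dyadic_first j" "2 ^ j \<le> b (dyadic_first j)"
    by (auto simp: dyadic_first_def)
qed

lemma dyadic_first_le: "1 \<le> n \<Longrightarrow> 2 ^ j \<le> b n \<Longrightarrow> dyadic_first j \<le> n"
  unfolding dyadic_first_def by (rule Least_le) simp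

text \<open>Move from \<open>n\<close> up to the last index of its dyadic range, where the
  domination is available. Undoing the weight costs at most \<open>real (b n) powr e\<close>; the
  second \<open>e\<close> makes the quotient tend to zero.\<close>

lemma limsup_eq_0_transfer:
  fixes s s' :: "nat \<Rightarrow> ennreal"
  assumes mono: "\<And>m n. 1 \<le> m \<Longrightarrow> m \<le> n \<Longrightarrow> s' m \<le> s' n"
    and e: "0 < e" and C: "0 < C"
    and dom: "\<And>j. ennreal ((2 powr - e) ^ j) * s' (dyadic_last j) \<le> ennreal C * s (dyadic_last j)"
    and lim: "limsup (\<lambda>n. s n / ennreal (real (b n) powr t)) = 0"
  shows "limsup (\<lambda>n. s' n / ennreal (real (b n) powr (t + 2 * e))) = 0"
proof -
  \<comment> \<open>\<open>C\<close> is the cost of the domination,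
    \<open>2 powr \<bar>t\<bar>\<close> that of replacing the count at the last index of the range
    by the count at \<open>n\<close>; these differ by a factor of at most 2.\<close>
  define K where "K = C * 2 powr \<bar>t\<bar>"
  have "eventually (\<lambda>n. s n / ennreal (real (b n) powr t) < 1) sequentially"
    by (rule Limsup_lessD) (simp add: lim)
  then obtain n0 where n0: "\<And>n. n0 \<le> n \<Longrightarrow> s n / ennreal (real (b n) powr t) < 1"
    by (auto simp: eventually_sequentially)
  have bound: "s' n / ennreal (real (b n) powr (t + 2 * e)) \<le> ennreal (K * real (b n) powr - e)"
    if n: "1 \<le> n" "n0 \<le> n" for n
  proof -
    obtain j where j: "2 ^ j \<le> b n" "b n < 2 ^ (j + 1)"
      using ex_power_ivl1[of 2 "b n"] count_pos[OF n(1)] by auto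
    let ?m = "dyadic_last j"
    have m: "n \<le> ?m" "b ?m < 2 ^ (j + 1)" using dyadic_last n j by auto
    have bm: "b n \<le> b ?m" "b ?m \<le> 2 * b n" using count_mono[OF n(1) m(1)] m(2) j(1) by auto
    have pos: "0 < real (b n)" "0 < real (b ?m)" using count_pos[OF n(1)] bm by auto
    have "real (2 ^ j) powr e \<le> real (b n) powr e"
      using j(1) e by (intro powr_mono2) (auto simp del: of_nat_power)
    moreover have "real (2 ^ j) powr e * (2 powr - e) ^ j = 1"
      by (simp add: powr_realpow[symmetric] powr_powr powr_add[symmetric] mult.commute)
    ultimately have q: "1 \<le> real (b n) powr e * (2 powr - e) ^ j"
      by (metis mult_right_mono zero_le_power powr_ge_zero)
    have sm: "s ?m \<le> ennreal (real (b ?m) powr t)"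
      using less_imp_le[OF n0[of ?m]] n m pos ennreal_divide_le_iff[of "real (b ?m) powr t" "s ?m" 1]
      by simp
    have "s' n \<le> s' ?m" by (rule mono) (use n m in auto)
    also have "\<dots> = 1 * s' ?m" by simp
    also have "\<dots> \<le> ennreal (real (b n) powr e * (2 powr - e) ^ j) * s' ?m"
      using q by (intro mult_right_mono) (auto simp: ennreal_leI ennreal_1[symmetric] simp del: ennreal_1)
    also have "\<dots> = ennreal (real (b n) powr e) * (ennreal ((2 powr - e) ^ j) * s' ?m)"
      by (subst ennreal_mult) (auto simp: mult.assoc)
    also have "\<dots> \<le> ennreal (real (b n) powr e) * (ennreal C * s ?m)"
      by (intro mult_left_mono dom) auto
    also have "\<dots> \<le> ennreal (real (b n) powr e) * (ennreal C * ennreal (real (b ?m) powr t))"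
      by (intro mult_left_mono sm) auto
    also have "\<dots> = ennreal (real (b n) powr e * (C * real (b ?m) powr t))"
      using C by (simp add: ennreal_mult)
    also have "\<dots> \<le> ennreal (real (b n) powr e * (C * (2 powr \<bar>t\<bar> * real (b n) powr t)))"
      using C pos bm
      by (intro ennreal_leI mult_left_mono powr_le_powr_of_comparable) auto
    also have "real (b n) powr e * (C * (2 powr \<bar>t\<bar> * real (b n) powr t))
      = K * real (b n) powr - e * real (b n) powr (t + 2 * e)"
      by (simp add: K_def powr_add[symmetric] mult.assoc)
    also have "ennreal \<dots> = ennreal (K * real (b n) powr - e) * ennreal (real (b n) powr (t + 2 * e))"
      using C by (intro ennreal_mult) (auto simp: K_def)
    finally show ?thesis using pos by (subst ennreal_divide_le_iff) auto
  qed
  have "((\<lambda>n. K * real (b n) powr - e) \<longlongrightarrow> K * 0) sequentially"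
    using e by (intro tendsto_intros tendsto_neg_powr filterlim_compose[OF filterlim_real_sequentially count_at_top]) auto
  then have lim0: "((\<lambda>n. ennreal (K * real (b n) powr - e)) \<longlongrightarrow> 0) sequentially"
    using tendsto_ennrealI[of "\<lambda>n. K * real (b n) powr - e" 0] by simp
  have "((\<lambda>n. s' n / ennreal (real (b n) powr (t + 2 * e))) \<longlongrightarrow> 0) sequentially"
  proof (rule tendsto_sandwich[OF _ _ tendsto_const lim0])
    show "\<forall>\<^sub>F n in sequentially. s' n / ennreal (real (b n) powr (t + 2 * e)) \<le> ennreal (K * real (b n) powr - e)"
      by (rule eventually_sequentiallyI[of "max 1 n0"], rule bound) simp_all
  qed simp
  then show ?thesis by (intro lim_imp_Limsup) auto
qed

text \<open>Here \<open>n\<close> moves down to the first index of its range. A single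
  \<open>e\<close> suffices, since the goal is a fixed positive lower bound and no decay has to be
  produced.\<close>

lemma liminf_pos_transfer:
  fixes s s' :: "nat \<Rightarrow> ennreal"
  assumes mono: "\<And>m n. 1 \<le> m \<Longrightarrow> m \<le> n \<Longrightarrow> s' m \<le> s' n"
    and e: "0 < e" and C: "0 < C"
    and dom: "\<And>j. ennreal ((2 powr - e) ^ j) * s (dyadic_first j) \<le> ennreal C * s' (dyadic_first j)"
    and lim: "0 < liminf (\<lambda>n. s n / ennreal (real (b n) powr t))"
  shows "0 < liminf (\<lambda>n. s' n / ennreal (real (b n) powr (t - e)))"
proof -
  \<comment> \<open>The lower limit may be infinite, so a finite level strictly below it is
    fixed.\<close>
  obtain y where y: "0 < y" "y < liminf (\<lambda>n. s n / ennreal (real (b n) powr t))"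
    using dense[OF lim] by auto
  then have "y < top" by (simp add: less_le_trans[OF _ top_greatest])
  then obtain c where c: "0 < c" "y = ennreal c"
    using y(1) by (auto simp: less_top_ennreal)
  define K where "K = c / (C * 2 powr \<bar>t\<bar>)"
  have K: "0 < K" using c C by (simp add: K_def)
  have "eventually (\<lambda>n. y < s n / ennreal (real (b n) powr t)) sequentially"
    using y(2) by (rule less_LiminfD)
  then obtain n0 where n0: "\<And>n. n0 \<le> n \<Longrightarrow> ennreal c < s n / ennreal (real (b n) powr t)"
    by (auto simp: eventually_sequentially c)
  have "eventually (\<lambda>n. ennreal K \<le> s' n / ennreal (real (b n) powr (t - e))) sequentially"
    \<comment> \<open>The factor 2 yields \<open>b (max 1 n0) < 2 ^ j\<close>, which by monotonicity
      puts the first index of the range beyond \<open>n0\<close>; \<open>max 1 n0\<close> stays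
      among the indices where monotonicity holds.\<close>
    using eventually_count_ge[of "2 * b (max 1 n0)"] eventually_ge_at_top[of 1]
  proof eventually_elim
    case (elim n)
    obtain j where j: "2 ^ j \<le> b n" "b n < 2 ^ (j + 1)"
      using ex_power_ivl1[of 2 "b n"] count_pos[OF elim(2)] by auto
    let ?m = "dyadic_first j"
    have m: "1 \<le> ?m" "2 ^ j \<le> b ?m" "?m \<le> n"
      using dyadic_first dyadic_first_le elim j by auto
    have bm: "b ?m \<le> b n" "b n \<le> 2 * b ?m" using count_mono[OF m(1,3)] m(2) j(2) by auto
    have pos: "0 < real (b n)" "0 < real (b ?m)" using count_pos elim m by (auto simp: Suc_le_eq)
    have "b (max 1 n0) < b ?m" using elim j m by simp
    then have "n0 \<le> ?m" using count_mono[OF m(1), of "max 1 n0"] by linarith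
    then have sm: "ennreal (c * real (b ?m) powr t) \<le> s ?m"
      using less_imp_le[OF n0[of ?m]] pos c by (simp add: le_ennreal_divide_iff ennreal_mult)
    have "real (b n) powr - e \<le> real (2 ^ j) powr - e"
      using j(1) e by (intro powr_mono2') (auto simp del: of_nat_power)
    also have "\<dots> = (2 powr - e) ^ j"
      by (simp add: powr_realpow[symmetric] powr_powr mult.commute)
    finally have q: "real (b n) powr - e \<le> (2 powr - e) ^ j" .
    have "real (b n) powr t \<le> 2 powr \<bar>t\<bar> * real (b ?m) powr t"
      using pos bm by (intro powr_le_powr_of_comparable) auto
    then have bt: "real (b n) powr t / 2 powr \<bar>t\<bar> \<le> real (b ?m) powr t"
      by (simp add: field_simps)
    have "ennreal C * ennreal (K * real (b n) powr (t - e)) = ennreal (C * (K * real (b n) powr (t - e)))"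
      using C K by (simp add: ennreal_mult)
    also have "C * (K * real (b n) powr (t - e))
      = real (b n) powr - e * (c * (real (b n) powr t / 2 powr \<bar>t\<bar>))"
      using C pos by (simp add: K_def powr_diff powr_minus_divide)
    also have "ennreal \<dots> \<le> ennreal ((2 powr - e) ^ j * (c * real (b ?m) powr t))"
      using q bt c by (intro ennreal_leI mult_mono mult_left_mono) auto
    also have "\<dots> = ennreal ((2 powr - e) ^ j) * ennreal (c * real (b ?m) powr t)"
      using c by (intro ennreal_mult) auto
    also have "\<dots> \<le> ennreal ((2 powr - e) ^ j) * s ?m"
      by (intro mult_left_mono sm) auto
    also have "\<dots> \<le> ennreal C * s' ?m" by (rule dom)
    also have "\<dots> \<le> ennreal C * s' n"
      using m by (intro mult_left_mono mono) auto
    finally have "ennreal (K * real (b n) powr (t - e)) \<le> s' n"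
      using C by (simp add: ennreal_mult_le_mult_iff)
    then show ?case
      using pos K by (simp add: le_ennreal_divide_iff ennreal_mult)
  qed
  then have "ennreal K \<le> liminf (\<lambda>n. s' n / ennreal (real (b n) powr (t - e)))"
    by (rule Liminf_bounded)
  moreover have "0 < ennreal K" using K by simp
  ultimately show ?thesis by (rule less_le_trans[rotated])
qed

end

lemma Sup_ereal_image_le:
  assumes "\<And>t e. t \<in> X \<Longrightarrow> 0 < e \<Longrightarrow> t - e \<in> Y"
  shows "Sup (ereal ` X) \<le> Sup (ereal ` Y)"
proof (rule Sup_least, safe)
  fix t assume t: "t \<in> X"
  show "ereal t \<le> Sup (ereal ` Y)"
  proof (rule ereal_le_epsilon2)
    fix e :: real assume "0 < e"
    then have "ereal (t - e) \<le> Sup (ereal ` Y)"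
      using assms t by (intro Sup_upper) auto
    then have "ereal (t - e) + ereal e \<le> Sup (ereal ` Y) + ereal e"
      by (rule add_right_mono)
    then show "ereal t \<le> Sup (ereal ` Y) + ereal e" by simp
  qed
qed

lemma Inf_ereal_image_le:
  assumes "\<And>t e. t \<in> X \<Longrightarrow> 0 < e \<Longrightarrow> t + e \<in> Y"
  shows "Inf (ereal ` Y) \<le> Inf (ereal ` X)"
proof (rule Inf_greatest, safe)
  fix t assume t: "t \<in> X"
  show "Inf (ereal ` Y) \<le> ereal t"
  proof (rule ereal_le_epsilon2)
    fix e :: real assume "0 < e"
    then have "Inf (ereal ` Y) \<le> ereal (t + e)"
      using assms t by (intro Inf_lower) auto
    then show "Inf (ereal ` Y) \<le> ereal t + ereal e" by simp
  qed
qed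

subsection \<open>Critical dimensions for equivalent measures\<close>

text \<open>These properties are all that the argument takes from the metric. An orthant is encoded
  by the set of coordinates with a nonnegative entry, a value of the finite type
  \<open>'d set\<close>.\<close>

locale box_family =
  fixes B :: "nat \<Rightarrow> (int ^ 'd) set"
  assumes finite_box: "1 \<le> n \<Longrightarrow> finite (B n)"
    and zero_in_box: "1 \<le> n \<Longrightarrow> 0 \<in> B n"
    and box_mono: "1 \<le> m \<Longrightarrow> m \<le> n \<Longrightarrow> B m \<subseteq> B n"
    and orthant_difference_in_box:
      "1 \<le> n \<Longrightarrow> u \<in> B n \<Longrightarrow> v \<in> B n \<Longrightarrow> {i. 0 \<le> u $ i} = {i. 0 \<le> v $ i} \<Longrightarrow> u - v \<in> B n"
    and card_box_at_top: "filterlim (\<lambda>n. card (B n)) at_top sequentially"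
begin

sublocale growing_counts "\<lambda>n. card (B n)"
proof
  fix m n :: nat
  show "1 \<le> card (B n)" if "1 \<le> n"
    using finite_box[OF that] zero_in_box[OF that] by (auto simp: Suc_le_eq card_gt_0_iff)
  show "card (B m) \<le> card (B n)" if "1 \<le> m" "m \<le> n"
    using that by (intro card_mono finite_box box_mono) auto
qed (rule card_box_at_top)

lemma orbit_sum_box_mono: "1 \<le> m \<Longrightarrow> m \<le> n \<Longrightarrow> orbit_sum M T (B m) x \<le> orbit_sum M T (B n) x"
  unfolding orbit_sum_def by (intro sum_mono2 finite_box box_mono) auto

lemma AE_orbit_sum_box_dominated:
  assumes "equivalent_actions M M' T" and r: "\<And>j. 1 \<le> r j" and q: "0 < q" "q < 1"
  shows "AE x in M. \<exists>C>0. \<forall>j. ennreal (q ^ j) * orbit_sum M' T (B (r j)) x \<le> ennreal C * orbit_sum M T (B (r j)) x"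
  using r q zero_in_box
  by (intro equivalent_actions.AE_orbit_sum_dominated[OF assms(1), where c = "\<lambda>u. {i. 0 \<le> u $ i}"]
      finite_box orthant_difference_in_box) auto

end

context nonsingular_prob_action
begin

lemma emeasure_lower_set_eq_1_iff:
  "emeasure M (lower_set M T B t) = 1 \<longleftrightarrow>
     (AE x in M. 0 < liminf (\<lambda>n. orbit_sum M T (B n) x / ennreal (real (card (B n)) powr t)))"
  unfolding lower_set_def normalized_sum_def orbit_sum_def[symmetric]
  by (rule AE_iff_emeasure_eq_1[symmetric]) measurable

lemma emeasure_upper_set_eq_1_iff:
  "emeasure M (upper_set M T B t) = 1 \<longleftrightarrow>
     (AE x in M. limsup (\<lambda>n. orbit_sum M T (B n) x / ennreal (real (card (B n)) powr t)) = 0)"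
  unfolding upper_set_def normalized_sum_def orbit_sum_def[symmetric]
  by (rule AE_iff_emeasure_eq_1[symmetric]) measurable

end

lemma equivalent_actions_sym: "equivalent_actions M M' T \<Longrightarrow> equivalent_actions M' M T"
  by (auto simp: equivalent_actions_def equivalent_actions_axioms_def equivalent_measures_def)

lemma powr_minus_less_1: "0 < e \<Longrightarrow> 2 powr - e < (1::real)"
  using powr_less_mono[of "- e" 0 2] by simp

text \<open>A lower bound on the sums of \<open>M'\<close> requires those of \<open>M\<close> to be
  dominated by them, so the domination is applied with the two measures interchanged and holds
  \<open>M'\<close>-almost everywhere.\<close>

lemma lower_critical_dimension_le:
  assumes "box_family B" and eq: "equivalent_actions M M' T"
  shows "lower_critical_dimension M T B \<le> lower_critical_dimension M' T B"
  unfolding lower_critical_dimension_def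
proof (rule Sup_ereal_image_le, clarify)
  interpret box_family B by fact
  interpret equivalent_actions M M' T by fact
  fix t e :: real assume t: "emeasure M (lower_set M T B t) = 1" and e: "0 < e"
  have "AE x in M'. \<exists>C>0. \<forall>j. ennreal ((2 powr - e) ^ j) * orbit_sum M T (B (dyadic_first j)) x
      \<le> ennreal C * orbit_sum M' T (B (dyadic_first j)) x"
    by (intro AE_orbit_sum_box_dominated equivalent_actions_sym[OF eq] dyadic_first powr_minus_less_1 e) simp
  moreover have "AE x in M'. 0 < liminf (\<lambda>n. orbit_sum M T (B n) x / ennreal (real (card (B n)) powr t))"
    using t unfolding emeasure_lower_set_eq_1_iff AE_cong_equivalent_measures[OF equivalent] .
  ultimately have "AE x in M'. 0 < liminf (\<lambda>n. orbit_sum M' T (B n) x / ennreal (real (card (B n)) powr (t - e)))"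
  proof eventually_elim
    case (elim x)
    then obtain C where "0 < C"
      "\<And>j. ennreal ((2 powr - e) ^ j) * orbit_sum M T (B (dyadic_first j)) x
        \<le> ennreal C * orbit_sum M' T (B (dyadic_first j)) x"
      by auto
    then show ?case
      using orbit_sum_box_mono e elim(2) by (intro liminf_pos_transfer) auto
  qed
  then show "emeasure M' (lower_set M' T B (t - e)) = 1"
    unfolding M'.emeasure_lower_set_eq_1_iff .
qed

text \<open>Here the sums of \<open>M'\<close> must be dominated by those of \<open>M\<close>, so
  the measures keep their places.\<close>

lemma upper_critical_dimension_le:
  assumes "box_family B" and eq: "equivalent_actions M M' T"
  shows "upper_critical_dimension M' T B \<le> upper_critical_dimension M T B"
  unfolding upper_critical_dimension_def
proof (rule Inf_ereal_image_le, clarify)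
  interpret box_family B by fact
  interpret equivalent_actions M M' T by fact
  fix t e :: real assume t: "emeasure M (upper_set M T B t) = 1" and e: "0 < e"
  \<comment> \<open>The transfer raises the exponent by twice its parameter.\<close>
  define d where "d = e / 2"
  have d: "0 < d" "t + e = t + 2 * d" using e by (auto simp: d_def)
  have "AE x in M. \<exists>C>0. \<forall>j. ennreal ((2 powr - d) ^ j) * orbit_sum M' T (B (dyadic_last j)) x
      \<le> ennreal C * orbit_sum M T (B (dyadic_last j)) x"
    by (intro AE_orbit_sum_box_dominated eq dyadic_last_ge_1 powr_minus_less_1 d) simp
  moreover have "AE x in M. limsup (\<lambda>n. orbit_sum M T (B n) x / ennreal (real (card (B n)) powr t)) = 0"
    using t unfolding emeasure_upper_set_eq_1_iff .
  ultimately have "AE x in M. limsup (\<lambda>n. orbit_sum M' T (B n) x / ennreal (real (card (B n)) powr (t + e))) = 0"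
  proof eventually_elim
    case (elim x)
    then obtain C where "0 < C"
      "\<And>j. ennreal ((2 powr - d) ^ j) * orbit_sum M' T (B (dyadic_last j)) x
        \<le> ennreal C * orbit_sum M T (B (dyadic_last j)) x"
      by auto
    then show ?case
      unfolding d(2) using orbit_sum_box_mono d(1) elim(2) by (intro limsup_eq_0_transfer) auto
  qed
  then show "emeasure M' (upper_set M' T B (t + e)) = 1"
    unfolding M'.emeasure_upper_set_eq_1_iff AE_cong_equivalent_measures[OF equivalent] .
qed

subsection \<open>Transport along an isomorphism\<close>

lemma null_sets_Int_conull:
  assumes "A \<in> sets M" "Z \<in> sets M" "emeasure M (space M - Z) = 0"
  shows "A \<inter> Z \<in> null_sets M \<longleftrightarrow> A \<in> null_sets M"
proof
  assume "A \<inter> Z \<in> null_sets M"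
  moreover have "space M - Z \<in> null_sets M" using assms by auto
  ultimately have "(A \<inter> Z) \<union> (space M - Z) \<in> null_sets M" by (rule null_sets.Un)
  then show "A \<in> null_sets M"
    by (rule null_sets_subset) (use assms sets.sets_into_space[of A M] in auto)
qed (rule null_set_Int2[OF _ assms(2)])

text \<open>Replaces the isomorphism and its inverse by maps between the whole spaces, so that later
  arguments avoid restricted spaces; off the conull sets the values are arbitrary constants.\<close>

lemma metrically_isomorphic_maps:
  assumes iso: "metrically_isomorphic M T N S"
    and M: "prob_space M" and N: "prob_space N"
  obtains \<phi> \<psi> where "\<phi> \<in> measurable M N" "\<psi> \<in> measurable N M"
    "\<And>u. AE y in N. \<phi> (T u (\<psi> y)) = S u y" "equivalent_measures (distr N M \<psi>) M"
proof -
  interpret M: prob_space M by fact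
  interpret N: prob_space N by fact
  obtain X0 Y0 \<theta> where sets [measurable]: "X0 \<in> sets M" "Y0 \<in> sets N"
    and X0: "invariant_set T X0" "emeasure M (space M - X0) = 0"
    and Y0: "invariant_set S Y0" "emeasure N (space N - Y0) = 0"
    and bij: "bij_betw \<theta> X0 Y0"
    and meas: "\<theta> \<in> measurable (restrict_space M X0) (restrict_space N Y0)"
      "the_inv_into X0 \<theta> \<in> measurable (restrict_space N Y0) (restrict_space M X0)"
    and equivariant: "\<And>u x. x \<in> X0 \<Longrightarrow> \<theta> (T u x) = S u (\<theta> x)"
    and equiv: "equivalent_measures
        (distr (restrict_space N Y0) (restrict_space M X0) (the_inv_into X0 \<theta>)) (restrict_space M X0)"
    using iso unfolding metrically_isomorphic_def by blast
  let ?\<eta> = "the_inv_into X0 \<theta>"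
  have subset: "X0 \<subseteq> space M" "Y0 \<subseteq> space N" using sets[THEN sets.sets_into_space] by auto
  obtain x0 y0 where x0: "x0 \<in> space M" and y0: "y0 \<in> space N"
    using M.not_empty N.not_empty by blast
  define \<phi> where "\<phi> = (\<lambda>x. if x \<in> X0 then \<theta> x else y0)"
  define \<psi> where "\<psi> = (\<lambda>y. if y \<in> Y0 then ?\<eta> y else x0)"
  have \<eta>: "?\<eta> y \<in> X0" "\<theta> (?\<eta> y) = y" if "y \<in> Y0" for y
    using that bij f_the_inv_into_f_bij_betw[OF bij] the_inv_into_into[of \<theta> X0 y X0]
    by (auto simp: bij_betw_def)
  have \<phi>_measurable: "\<phi> \<in> measurable M N"
    unfolding \<phi>_def using meas(1) y0 by (subst measurable_If_restrict_space_iff) (auto simp: measurable_restrict_space2_iff)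
  have \<psi>_measurable [measurable]: "\<psi> \<in> measurable N M"
    unfolding \<psi>_def using meas(2) x0 by (subst measurable_If_restrict_space_iff) (auto simp: measurable_restrict_space2_iff)
  have "AE y in N. y \<in> Y0"
    using Y0(2) by (intro AE_I[where N = "space N - Y0"]) auto
  then have equivariant': "AE y in N. \<phi> (T u (\<psi> y)) = S u y" for u
  proof eventually_elim
    case (elim y)
    then have "T u (?\<eta> y) \<in> X0"
      using X0(1) \<eta>(1)[of y] unfolding invariant_set_def by blast
    then show ?case using elim \<eta> by (simp add: \<phi>_def \<psi>_def equivariant)
  qed
  \<comment> \<open>Equivalence is given only on the restriction to \<open>X0\<close>. Intersecting
    with the conull sets \<open>X0\<close> and \<open>Y0\<close> does not affect nullness, which
    carries it over to all of \<open>M\<close>.\<close>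
  have null_iff: "A \<in> null_sets (distr N M \<psi>) \<longleftrightarrow> A \<in> null_sets M" if [measurable]: "A \<in> sets M" for A
  proof -
    define E where "E = ?\<eta> -` (A \<inter> X0) \<inter> space (restrict_space N Y0)"
    have E: "E \<subseteq> Y0" by (auto simp: E_def space_restrict_space)
    have A: "A \<inter> X0 \<in> sets (restrict_space M X0)" by (simp add: sets_restrict_space_iff)
    have "A \<in> null_sets (distr N M \<psi>) \<longleftrightarrow> \<psi> -` A \<inter> space N \<in> null_sets N"
      by (simp add: null_sets_distr_iff)
    also have "\<dots> \<longleftrightarrow> (\<psi> -` A \<inter> space N) \<inter> Y0 \<in> null_sets N"
      by (rule null_sets_Int_conull[symmetric]) (use Y0 in auto)
    also have "(\<psi> -` A \<inter> space N) \<inter> Y0 = E"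
      unfolding E_def \<psi>_def using subset \<eta>(1) by (auto simp: space_restrict_space)
    also have "E \<in> null_sets N \<longleftrightarrow> E \<in> null_sets (restrict_space N Y0)"
      using E by (simp add: null_sets_restrict_space)
    also have "\<dots> \<longleftrightarrow> A \<inter> X0 \<in> null_sets (distr (restrict_space N Y0) (restrict_space M X0) ?\<eta>)"
      unfolding E_def by (simp only: null_sets_distr_iff[OF meas(2)] A simp_thms)
    also have "\<dots> \<longleftrightarrow> A \<inter> X0 \<in> null_sets (restrict_space M X0)"
      using equiv by (auto simp: equivalent_measures_def absolutely_continuous_def)
    also have "\<dots> \<longleftrightarrow> A \<inter> X0 \<in> null_sets M"
      by (subst null_sets_restrict_space) auto
    also have "\<dots> \<longleftrightarrow> A \<in> null_sets M"
      by (rule null_sets_Int_conull) (use X0 in auto)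
    finally show ?thesis .
  qed
  have "null_sets (distr N M \<psi>) = null_sets M"
    using null_iff null_setsD2[of _ M] null_setsD2[of _ "distr N M \<psi>"] unfolding sets_distr by blast
  then have "equivalent_measures (distr N M \<psi>) M"
    by (simp add: equivalent_measures_def absolutely_continuous_def)
  with \<phi>_measurable \<psi>_measurable equivariant' show thesis by (rule that)
qed

text \<open>Pulled back along \<open>\<psi>\<close>, the cocycle passes the test of
  \<open>cocycle_unique\<close> for \<open>N\<close>: since \<open>\<phi>\<close> inverts
  \<open>\<psi>\<close> almost everywhere, test functions on \<open>N\<close> can be moved to
  \<open>M\<close> and back.\<close>

lemma AE_cocycle_distr:
  fixes M :: "'a measure" and N :: "'b measure"
  assumes N: "nonsingular_prob_action N S" and D: "nonsingular_prob_action (distr N M \<psi>) T"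
    and [measurable]: "\<phi> \<in> measurable M N" "\<psi> \<in> measurable N M"
    and equivariant: "\<And>u. AE y in N. \<phi> (T u (\<psi> y)) = S u y"
  shows "AE y in N. cocycle (distr N M \<psi>) T u (\<psi> y) = cocycle N S u y"
proof -
  interpret nonsingular_prob_action N S by fact
  interpret D: nonsingular_prob_action "distr N M \<psi>" T by fact
  let ?D = "distr N M \<psi>"
  have [measurable]: "T u \<in> measurable M M" for u
    using D.action_measurable[of u] by simp
  have [measurable]: "cocycle ?D T u \<in> borel_measurable M" for u
    using D.cocycle_measurable[of u] by simp
  \<comment> \<open>The case \<open>u = 0\<close> of equivariance, as 0 acts trivially on both
    sides.\<close>
  have retract: "AE y in N. \<phi> (\<psi> y) = y"
    using equivariant[of 0] AE_space
  proof eventually_elim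
    case (elim y)
    then have "\<psi> y \<in> space ?D" using measurable_space[of \<psi> N M y] by simp
    then show ?case using elim D.action_zero action_zero by simp
  qed
  show ?thesis
  proof (rule cocycle_unique)
    fix f :: "'b \<Rightarrow> ennreal" assume [measurable]: "f \<in> borel_measurable N"
    have "(\<integral>\<^sup>+y. f (S u y) * cocycle ?D T u (\<psi> y) \<partial>N)
      = (\<integral>\<^sup>+y. f (\<phi> (T u (\<psi> y))) * cocycle ?D T u (\<psi> y) \<partial>N)"
      by (rule nn_integral_cong_AE, rule eventually_mono[OF equivariant[of u]]) (simp only:)
    also have "\<dots> = (\<integral>\<^sup>+x. f (\<phi> (T u x)) * cocycle ?D T u x \<partial>?D)"
      by (subst nn_integral_distr) auto
    also have "\<dots> = (\<integral>\<^sup>+x. f (\<phi> x) \<partial>?D)"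
      by (rule D.nn_integral_cocycle) simp
    also have "\<dots> = (\<integral>\<^sup>+y. f (\<phi> (\<psi> y)) \<partial>N)"
      by (subst nn_integral_distr) auto
    also have "\<dots> = (\<integral>\<^sup>+y. f y \<partial>N)"
      by (rule nn_integral_cong_AE, rule eventually_mono[OF retract]) (simp only:)
    finally show "(\<integral>\<^sup>+y. f (S u y) * cocycle ?D T u (\<psi> y) \<partial>N) = (\<integral>\<^sup>+y. f y \<partial>N)" .
  qed measurable
qed

lemma critical_dimensions_distr:
  fixes M :: "'a measure" and N :: "'b measure"
  assumes N: "nonsingular_prob_action N S" and D: "nonsingular_prob_action (distr N M \<psi>) T"
    and \<phi>: "\<phi> \<in> measurable M N" and \<psi>: "\<psi> \<in> measurable N M"
    and equivariant: "\<And>u. AE y in N. \<phi> (T u (\<psi> y)) = S u y"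
  shows "lower_critical_dimension (distr N M \<psi>) T B = lower_critical_dimension N S B"
    and "upper_critical_dimension (distr N M \<psi>) T B = upper_critical_dimension N S B"
proof -
  interpret nonsingular_prob_action N S by fact
  interpret D: nonsingular_prob_action "distr N M \<psi>" T by fact
  note [measurable] = \<psi>
  let ?D = "distr N M \<psi>"
  have [measurable]: "orbit_sum ?D T A \<in> borel_measurable M" for A
    using D.orbit_sum_measurable[of A] by simp
  \<comment> \<open>The group is countable, so one null set serves all \<open>u\<close>, and with
    them all orbit sums.\<close>
  have "AE y in N. \<forall>u. cocycle ?D T u (\<psi> y) = cocycle N S u y"
    unfolding AE_all_countable using AE_cocycle_distr[OF assms] by blast
  then have *: "AE y in N. \<forall>A. orbit_sum ?D T A (\<psi> y) = orbit_sum N S A y"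
    by eventually_elim (simp add: orbit_sum_def)
  have transfer: "(AE x in ?D. P (\<lambda>n. orbit_sum ?D T (B n) x)) \<longleftrightarrow> (AE y in N. P (\<lambda>n. orbit_sum N S (B n) y))"
    if "{x \<in> space M. P (\<lambda>n. orbit_sum ?D T (B n) x)} \<in> sets M" for P
  proof -
    have "(AE x in ?D. P (\<lambda>n. orbit_sum ?D T (B n) x)) \<longleftrightarrow> (AE y in N. P (\<lambda>n. orbit_sum ?D T (B n) (\<psi> y)))"
      using that by (intro AE_distr_iff) auto
    also have "\<dots> \<longleftrightarrow> (AE y in N. P (\<lambda>n. orbit_sum N S (B n) y))"
    proof
      assume "AE y in N. P (\<lambda>n. orbit_sum ?D T (B n) (\<psi> y))"
      with * show "AE y in N. P (\<lambda>n. orbit_sum N S (B n) y)" by eventually_elim simp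
    next
      assume "AE y in N. P (\<lambda>n. orbit_sum N S (B n) y)"
      with * show "AE y in N. P (\<lambda>n. orbit_sum ?D T (B n) (\<psi> y))" by eventually_elim simp
    qed
    finally show ?thesis .
  qed
  have "(AE x in ?D. 0 < liminf (\<lambda>n. orbit_sum ?D T (B n) x / ennreal (real (card (B n)) powr t)))
    \<longleftrightarrow> (AE y in N. 0 < liminf (\<lambda>n. orbit_sum N S (B n) y / ennreal (real (card (B n)) powr t)))" for t
    by (rule transfer[of "\<lambda>s. 0 < liminf (\<lambda>n. s n / ennreal (real (card (B n)) powr t))"]) measurable
  then show "lower_critical_dimension ?D T B = lower_critical_dimension N S B"
    by (simp add: lower_critical_dimension_def emeasure_lower_set_eq_1_iff D.emeasure_lower_set_eq_1_iff)
  have "(AE x in ?D. limsup (\<lambda>n. orbit_sum ?D T (B n) x / ennreal (real (card (B n)) powr t)) = 0)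
    \<longleftrightarrow> (AE y in N. limsup (\<lambda>n. orbit_sum N S (B n) y / ennreal (real (card (B n)) powr t)) = 0)" for t
    by (rule transfer[of "\<lambda>s. limsup (\<lambda>n. s n / ennreal (real (card (B n)) powr t)) = 0"]) measurable
  then show "upper_critical_dimension ?D T B = upper_critical_dimension N S B"
    by (simp add: upper_critical_dimension_def emeasure_upper_set_eq_1_iff D.emeasure_upper_set_eq_1_iff)
qed

subsection \<open>Rectangular metrics\<close>

text \<open>A maximum is at most \<open>n\<close> exactly if every coordinate obeys its own bound,
  so the balls are boxes; as each \<open>F i\<close> increases, only absolute values of coordinates
  have to be compared.\<close>

lemma box_family_rectangular_metric:
  fixes \<rho> :: "int ^ 'd \<Rightarrow> int ^ 'd \<Rightarrow> real"
  assumes \<rho>: "rectangular_metric \<rho>"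
    and B: "\<And>n. n \<ge> 1 \<Longrightarrow> B n = {u. \<rho> u 0 \<le> real n}"
  shows "box_family B"
proof -
  obtain F :: "'d \<Rightarrow> real \<Rightarrow> real" where F0: "\<And>i. F i 0 = 0"
    and strict: "\<And>i. strict_mono_on {0..} (F i)" and bij: "\<And>i. bij_betw (F i) {0..} {0..}"
    and F: "\<And>u v. \<rho> u v = Max (range (\<lambda>i. F i (real_of_int \<bar>u $ i - v $ i\<bar>)))"
    using \<rho> unfolding rectangular_metric_def by blast
  have mono: "F i x \<le> F i y" if "0 \<le> x" "x \<le> y" for i x y
    using strict_mono_on_leD[OF strict[of i]] that by auto
  have in_B: "u \<in> B n \<longleftrightarrow> (\<forall>i. F i (real_of_int \<bar>u $ i\<bar>) \<le> real n)" if "1 \<le> n" for n u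
    using that by (simp add: B F)
  have finite_B: "finite (B n)" if n: "1 \<le> n" for n
  proof -
    \<comment> \<open>Surjectivity of \<open>F i\<close> supplies the half-length of the box in
      direction \<open>i\<close>.\<close>
    have "\<exists>x\<ge>0. F i x = real n" for i
      using bij_betw_imp_surj_on[OF bij[of i]] by (metis atLeast_iff imageE of_nat_0_le_iff)
    then obtain f where f: "\<And>i. 0 \<le> f i" "\<And>i. F i (f i) = real n" by metis
    have "u \<in> (\<lambda>g. \<chi> i. g i) ` (\<Pi>\<^sub>E i\<in>UNIV. {-\<lfloor>f i\<rfloor>..\<lfloor>f i\<rfloor>})" if u: "u \<in> B n" for u
    proof -
      have "real_of_int \<bar>u $ i\<bar> \<le> f i" for i
      proof (rule ccontr)
        assume "\<not> ?thesis"
        then have "F i (f i) < F i (real_of_int \<bar>u $ i\<bar>)"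
          using strict_mono_onD[OF strict[of i]] f(1)[of i] by auto
        then show False using u n f(2)[of i] by (auto simp: in_B not_less[symmetric])
      qed
      then have "\<bar>u $ i\<bar> \<le> \<lfloor>f i\<rfloor>" for i
        by (simp add: le_floor_iff)
      then have "- \<lfloor>f i\<rfloor> \<le> u $ i \<and> u $ i \<le> \<lfloor>f i\<rfloor>" for i
        by (simp add: abs_le_iff minus_le_iff)
      then show ?thesis
        by (intro image_eqI[of _ _ "\<lambda>i. u $ i"]) (auto simp: vec_eq_iff)
    qed
    then have "B n \<subseteq> (\<lambda>g. \<chi> i. g i) ` (\<Pi>\<^sub>E i\<in>UNIV. {-\<lfloor>f i\<rfloor>..\<lfloor>f i\<rfloor>})" by blast
    then show ?thesis
      by (rule finite_subset) (intro finite_imageI finite_PiE, auto)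
  qed
  show ?thesis
  proof
    fix n :: nat assume n: "1 \<le> n"
    show "0 \<in> B n" using n by (simp add: in_B F0)
    show "B n \<subseteq> B m" if "n \<le> m" for m
      using that n by (fastforce simp: in_B intro: order_trans)
    show "finite (B n)" using n by (rule finite_B)
    show "u - v \<in> B n"
      if u: "u \<in> B n" and v: "v \<in> B n" and sgn: "{i. 0 \<le> u $ i} = {i. 0 \<le> v $ i}" for u v
      unfolding in_B[OF n]
    proof
      fix i
      \<comment> \<open>Integers of the same sign, with zero counted as nonnegative, differ by at
        most the larger absolute value.\<close>
      have "\<bar>(u - v) $ i\<bar> \<le> \<bar>u $ i\<bar> \<or> \<bar>(u - v) $ i\<bar> \<le> \<bar>v $ i\<bar>"
        using sgn by (auto simp: set_eq_iff abs_if not_less dest!: spec[of _ i])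
      then have "F i (real_of_int \<bar>(u - v) $ i\<bar>) \<le> F i (real_of_int \<bar>u $ i\<bar>)
          \<or> F i (real_of_int \<bar>(u - v) $ i\<bar>) \<le> F i (real_of_int \<bar>v $ i\<bar>)"
        by (auto intro!: mono simp del: vector_minus_component of_int_abs)
      then show "F i (real_of_int \<bar>(u - v) $ i\<bar>) \<le> real n"
        using u v n by (auto simp: in_B intro: order_trans)
    qed
  next
    have ev: "eventually (\<lambda>n. u \<in> B n) sequentially" for u
      using eventually_ge_at_top[of 1] eventually_ge_at_top[of "nat \<lceil>\<rho> u 0\<rceil>"]
      by eventually_elim (auto simp: B)
    show "filterlim (\<lambda>n. card (B n)) at_top sequentially"
      unfolding filterlim_at_top
    proof
      fix k :: nat
      \<comment> \<open>These are \<open>k\<close> distinct points of the diagonal; each lies in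
        \<open>B n\<close> for all large \<open>n\<close>, so the count eventually reaches
        \<open>k\<close>.\<close>
      let ?D = "(\<lambda>l::nat. (\<chi> i. int l) :: int ^ 'd) ` {..<k}"
      have card: "card ?D = k"
        by (subst card_image) (auto simp: inj_on_def vec_eq_iff)
      have "eventually (\<lambda>n. \<forall>u\<in>?D. u \<in> B n) sequentially"
        using ev by (intro eventually_ball_finite) auto
      then show "eventually (\<lambda>n. k \<le> card (B n)) sequentially"
        using eventually_ge_at_top[of 1]
      proof eventually_elim
        case (elim n)
        then have "card ?D \<le> card (B n)"
          by (intro card_mono finite_B) auto
        then show ?case by (simp add: card)
      qed
    qed
  qed
qed

theorem corollary1p4:
  fixes \<rho> :: "int ^ 'd \<Rightarrow> int ^ 'd \<Rightarrow> real"
    and B :: "nat \<Rightarrow> (int ^ 'd) set"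
    and M :: "'a measure" and T :: "int ^ 'd \<Rightarrow> 'a \<Rightarrow> 'a"
    and N :: "'b measure" and S :: "int ^ 'd \<Rightarrow> 'b \<Rightarrow> 'b"
  assumes "rectangular_metric \<rho>"
    and "\<And>n. n \<ge> 1 \<Longrightarrow> B n = {u. \<rho> u 0 \<le> real n}"
    and "standard_prob_space M" "nonsingular_action M T" "ergodic_action M T"
    and "standard_prob_space N" "nonsingular_action N S" "ergodic_action N S"
    and "metrically_isomorphic M T N S"
  shows "lower_critical_dimension M T B = lower_critical_dimension N S B \<and>
         upper_critical_dimension M T B = upper_critical_dimension N S B"
proof -
  have B: "box_family B"
    using assms(1,2) by (rule box_family_rectangular_metric)
  have M: "nonsingular_prob_action M T" and N: "nonsingular_prob_action N S"
    using assms(3,4,6,7) by (auto simp: nonsingular_prob_action_def standard_prob_space_def)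
  interpret M: nonsingular_prob_action M T by (rule M)
  interpret N: nonsingular_prob_action N S by (rule N)
  obtain \<phi> \<psi> where maps: "\<phi> \<in> measurable M N" "\<psi> \<in> measurable N M"
    "\<And>u. AE y in N. \<phi> (T u (\<psi> y)) = S u y" and equiv: "equivalent_measures (distr N M \<psi>) M"
    using metrically_isomorphic_maps[OF assms(9) M.prob_space_axioms N.prob_space_axioms] by blast
  \<comment> \<open>Pushing \<open>N\<close> forward along \<open>\<psi>\<close> puts both measures
    under the same action \<open>T\<close>.\<close>
  have D: "nonsingular_prob_action (distr N M \<psi>) T"
    unfolding nonsingular_prob_action_def
    using nonsingular_action_equivalent_measure[OF assms(4) equiv] N.prob_space_distr[OF maps(2)] by simp
  have eq: "equivalent_actions M (distr N M \<psi>) T"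
    using M D equiv by (simp add: equivalent_actions_def equivalent_actions_axioms_def)
  note sym = equivalent_actions_sym[OF eq]
  \<comment> \<open>Equivalence is symmetric, so each inequality holds in both directions; the
    push-forward has the critical dimensions of \<open>N\<close>.\<close>
  show ?thesis
    using lower_critical_dimension_le[OF B eq] lower_critical_dimension_le[OF B sym]
      upper_critical_dimension_le[OF B eq] upper_critical_dimension_le[OF B sym]
      critical_dimensions_distr[OF N D maps, of B]
    by auto
qed

end
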